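(* Every non-degenerate $\mathrm{B}$-category $\mathcal{B}$ is finitely co-complete, i.e., has all finite co-limits.
   Context: In a category with finite co-products, write $\mathbf{0}$ for the initial object; an object is empty if it is isomorphic to $\mathbf{0}$. An object $X$ is an atom (atomic) if it is non-empty and, whenever $X \cong Y \amalg Z$, either $Y$ or $Z$ is empty. A $\mathrm{B}$-category is an essentially small category $\mathcal{B}$ such that: (a) $\mathcal{B}$ has finite co-products; (b) every object is isomorphic to a finite co-product of atoms; (c) for objects $X,Y,Z$ with $X$ atomic, the natural map $\mathrm{Hom}(X,Y)\amalg \mathrm{Hom}(X,Z)\to \mathrm{Hom}(X,Y\amalg Z)$ is a bijection; (d) $\mathcal{B}$ has fiber products and a final object $\mathbf{1}$; (e) any monomorphism of atoms is an isomorphism. It is non-degenerate if $\mathbf{1}$ is atomic and, for all maps of atoms $X\to Z$ and $Y\to Z$, the fiber product $X\times_Z Y$ is non-empty. *)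

theory Defs
  imports Main
begin

text \<open>
  Objects and arrows form sets over arbitrary HOL types, so every category below is
  small. Essential smallness is therefore not a separate hypothesis: a (locally small)
  category is essentially small iff it is equivalent to one of this kind.
\<close>

record ('o, 'm) cat =
  Obj :: "'o set"
  Arr :: "'m set"
  Dom :: "'m \<Rightarrow> 'o"
  Cod :: "'m \<Rightarrow> 'o"
  Idt :: "'o \<Rightarrow> 'm"
  Comp :: "'m \<Rightarrow> 'm \<Rightarrow> 'm"  \<comment> \<open>\<open>Comp C g f\<close> is \<open>g\<close> after \<open>f\<close>; only relevant for composable arrows\<close>

definition Hom :: "('o, 'm) cat \<Rightarrow> 'o \<Rightarrow> 'o \<Rightarrow> 'm set" where
  "Hom C X Y = {f \<in> Arr C. Dom C f = X \<and> Cod C f = Y}"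

locale category =
  fixes C :: "('o, 'm) cat"
  assumes Dom_in_Obj: "f \<in> Arr C \<Longrightarrow> Dom C f \<in> Obj C"
    and Cod_in_Obj: "f \<in> Arr C \<Longrightarrow> Cod C f \<in> Obj C"
    and Idt_in_Hom: "X \<in> Obj C \<Longrightarrow> Idt C X \<in> Hom C X X"
    and Comp_in_Hom: "f \<in> Hom C X Y \<Longrightarrow> g \<in> Hom C Y Z \<Longrightarrow> Comp C g f \<in> Hom C X Z"
    and Comp_Idt_left: "f \<in> Hom C X Y \<Longrightarrow> Comp C (Idt C Y) f = f"
    and Comp_Idt_right: "f \<in> Hom C X Y \<Longrightarrow> Comp C f (Idt C X) = f"
    and Comp_assoc: "f \<in> Hom C W X \<Longrightarrow> g \<in> Hom C X Y \<Longrightarrow> h \<in> Hom C Y Z \<Longrightarrow>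
      Comp C h (Comp C g f) = Comp C (Comp C h g) f"


definition is_iso :: "('o, 'm) cat \<Rightarrow> 'o \<Rightarrow> 'o \<Rightarrow> 'm \<Rightarrow> bool" where
  "is_iso C X Y f \<longleftrightarrow> f \<in> Hom C X Y \<and>
     (\<exists>g \<in> Hom C Y X. Comp C g f = Idt C X \<and> Comp C f g = Idt C Y)"

definition isomorphic :: "('o, 'm) cat \<Rightarrow> 'o \<Rightarrow> 'o \<Rightarrow> bool" where
  "isomorphic C X Y \<longleftrightarrow> X \<in> Obj C \<and> Y \<in> Obj C \<and> (\<exists>f. is_iso C X Y f)"

definition is_mono :: "('o, 'm) cat \<Rightarrow> 'o \<Rightarrow> 'o \<Rightarrow> 'm \<Rightarrow> bool" where
  "is_mono C X Y f \<longleftrightarrow> f \<in> Hom C X Y \<and>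
     (\<forall>W \<in> Obj C. \<forall>g \<in> Hom C W X. \<forall>h \<in> Hom C W X. Comp C f g = Comp C f h \<longrightarrow> g = h)"

definition is_initial :: "('o, 'm) cat \<Rightarrow> 'o \<Rightarrow> bool" where
  "is_initial C I \<longleftrightarrow> I \<in> Obj C \<and> (\<forall>X \<in> Obj C. \<exists>!f. f \<in> Hom C I X)"

definition is_final :: "('o, 'm) cat \<Rightarrow> 'o \<Rightarrow> bool" where
  "is_final C T \<longleftrightarrow> T \<in> Obj C \<and> (\<forall>X \<in> Obj C. \<exists>!f. f \<in> Hom C X T)"

definition is_coproduct2 :: "('o, 'm) cat \<Rightarrow> 'o \<Rightarrow> 'o \<Rightarrow> 'o \<Rightarrow> 'm \<Rightarrow> 'm \<Rightarrow> bool" where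
  "is_coproduct2 C Y Z W i j \<longleftrightarrow>
     W \<in> Obj C \<and> i \<in> Hom C Y W \<and> j \<in> Hom C Z W \<and>
     (\<forall>T \<in> Obj C. \<forall>f \<in> Hom C Y T. \<forall>g \<in> Hom C Z T.
        \<exists>!h. h \<in> Hom C W T \<and> Comp C h i = f \<and> Comp C h j = g)"

definition is_coproduct :: "('o, 'm) cat \<Rightarrow> 'i set \<Rightarrow> ('i \<Rightarrow> 'o) \<Rightarrow> 'o \<Rightarrow> ('i \<Rightarrow> 'm) \<Rightarrow> bool" where
  "is_coproduct C I A W \<iota> \<longleftrightarrow>
     W \<in> Obj C \<and> (\<forall>i \<in> I. \<iota> i \<in> Hom C (A i) W) \<and>
     (\<forall>T \<in> Obj C. \<forall>f. (\<forall>i \<in> I. f i \<in> Hom C (A i) T) \<longrightarrow>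
        (\<exists>!h. h \<in> Hom C W T \<and> (\<forall>i \<in> I. Comp C h (\<iota> i) = f i)))"

text \<open>\<open>P\<close> with projections \<open>p\<close>, \<open>q\<close> is a fiber product of \<open>f : X \<rightarrow> Z\<close> and \<open>g : Y \<rightarrow> Z\<close>.\<close>

definition is_fiber_product ::
  "('o, 'm) cat \<Rightarrow> 'o \<Rightarrow> 'o \<Rightarrow> 'm \<Rightarrow> 'm \<Rightarrow> 'o \<Rightarrow> 'm \<Rightarrow> 'm \<Rightarrow> bool" where
  "is_fiber_product C X Y f g P p q \<longleftrightarrow>
     P \<in> Obj C \<and> p \<in> Hom C P X \<and> q \<in> Hom C P Y \<and> Comp C f p = Comp C g q \<and>
     (\<forall>T \<in> Obj C. \<forall>u \<in> Hom C T X. \<forall>v \<in> Hom C T Y. Comp C f u = Comp C g v \<longrightarrow>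
        (\<exists>!h. h \<in> Hom C T P \<and> Comp C p h = u \<and> Comp C q h = v))"


definition is_empty_obj :: "('o, 'm) cat \<Rightarrow> 'o \<Rightarrow> bool" where
  "is_empty_obj C X \<longleftrightarrow> (\<exists>I. is_initial C I \<and> isomorphic C X I)"

definition is_atom :: "('o, 'm) cat \<Rightarrow> 'o \<Rightarrow> bool" where
  "is_atom C X \<longleftrightarrow> X \<in> Obj C \<and> \<not> is_empty_obj C X \<and>
     (\<forall>Y \<in> Obj C. \<forall>Z \<in> Obj C. \<forall>W i j.
        is_coproduct2 C Y Z W i j \<and> isomorphic C X W \<longrightarrow> is_empty_obj C Y \<or> is_empty_obj C Z)"

locale B_category = category C for C :: "('o, 'm) cat" +
  assumes finite_coproducts:
      "\<And>(n :: nat) A. (\<And>i. i < n \<Longrightarrow> A i \<in> Obj C) \<Longrightarrow> \<exists>W \<iota>. is_coproduct C {..<n} A W \<iota>"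
    and atomic_decomposition:
      "\<And>X. X \<in> Obj C \<Longrightarrow>
         \<exists>(n :: nat) A W \<iota>. (\<forall>i<n. is_atom C (A i)) \<and> is_coproduct C {..<n} A W \<iota> \<and> isomorphic C X W"
    and Hom_atom_coproduct:
      "\<And>X Y Z W i j. is_atom C X \<Longrightarrow> Y \<in> Obj C \<Longrightarrow> Z \<in> Obj C \<Longrightarrow> is_coproduct2 C Y Z W i j \<Longrightarrow>
         bij_betw (case_sum (Comp C i) (Comp C j)) (Hom C X Y <+> Hom C X Z) (Hom C X W)"
    and fiber_products:
      "\<And>X Y Z f g. f \<in> Hom C X Z \<Longrightarrow> g \<in> Hom C Y Z \<Longrightarrow> \<exists>P p q. is_fiber_product C X Y f g P p q"
    and final_object: "\<exists>T. is_final C T"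
    and mono_atoms_iso:
      "\<And>X Y f. is_atom C X \<Longrightarrow> is_atom C Y \<Longrightarrow> is_mono C X Y f \<Longrightarrow> is_iso C X Y f"

locale nondegenerate_B_category = B_category C for C :: "('o, 'm) cat" +
  assumes final_atomic: "\<And>T. is_final C T \<Longrightarrow> is_atom C T"
    and fiber_product_nonempty:
      "\<And>X Y Z f g P p q. is_atom C X \<Longrightarrow> is_atom C Y \<Longrightarrow> is_atom C Z \<Longrightarrow>
         f \<in> Hom C X Z \<Longrightarrow> g \<in> Hom C Y Z \<Longrightarrow> is_fiber_product C X Y f g P p q \<Longrightarrow>
         \<not> is_empty_obj C P"


definition finite_category :: "('j, 'k) cat \<Rightarrow> bool" where
  "finite_category J \<longleftrightarrow> category J \<and> finite (Obj J) \<and> finite (Arr J)"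

definition is_functor ::
  "('j, 'k) cat \<Rightarrow> ('o, 'm) cat \<Rightarrow> ('j \<Rightarrow> 'o) \<Rightarrow> ('k \<Rightarrow> 'm) \<Rightarrow> bool" where
  "is_functor J C F\<^sub>o F\<^sub>m \<longleftrightarrow>
     (\<forall>x \<in> Obj J. F\<^sub>o x \<in> Obj C) \<and>
     (\<forall>x \<in> Obj J. \<forall>y \<in> Obj J. \<forall>a \<in> Hom J x y. F\<^sub>m a \<in> Hom C (F\<^sub>o x) (F\<^sub>o y)) \<and>
     (\<forall>x \<in> Obj J. F\<^sub>m (Idt J x) = Idt C (F\<^sub>o x)) \<and>
     (\<forall>x \<in> Obj J. \<forall>y \<in> Obj J. \<forall>z \<in> Obj J. \<forall>a \<in> Hom J x y. \<forall>b \<in> Hom J y z.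
        F\<^sub>m (Comp J b a) = Comp C (F\<^sub>m b) (F\<^sub>m a))"

definition is_cocone ::
  "('j, 'k) cat \<Rightarrow> ('o, 'm) cat \<Rightarrow> ('j \<Rightarrow> 'o) \<Rightarrow> ('k \<Rightarrow> 'm) \<Rightarrow> 'o \<Rightarrow> ('j \<Rightarrow> 'm) \<Rightarrow> bool" where
  "is_cocone J C F\<^sub>o F\<^sub>m L \<kappa> \<longleftrightarrow>
     L \<in> Obj C \<and> (\<forall>x \<in> Obj J. \<kappa> x \<in> Hom C (F\<^sub>o x) L) \<and>
     (\<forall>x \<in> Obj J. \<forall>y \<in> Obj J. \<forall>a \<in> Hom J x y. Comp C (\<kappa> y) (F\<^sub>m a) = \<kappa> x)"

definition is_colimit ::
  "('j, 'k) cat \<Rightarrow> ('o, 'm) cat \<Rightarrow> ('j \<Rightarrow> 'o) \<Rightarrow> ('k \<Rightarrow> 'm) \<Rightarrow> 'o \<Rightarrow> ('j \<Rightarrow> 'm) \<Rightarrow> bool" where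
  "is_colimit J C F\<^sub>o F\<^sub>m L \<kappa> \<longleftrightarrow>
     is_cocone J C F\<^sub>o F\<^sub>m L \<kappa> \<and>
     (\<forall>T \<mu>. is_cocone J C F\<^sub>o F\<^sub>m T \<mu> \<longrightarrow>
        (\<exists>!h. h \<in> Hom C L T \<and> (\<forall>x \<in> Obj J. Comp C h (\<kappa> x) = \<mu> x)))"

definition has_colimits_of_shape :: "('j, 'k) cat \<Rightarrow> ('o, 'm) cat \<Rightarrow> bool" where
  "has_colimits_of_shape J C \<longleftrightarrow>
     (\<forall>F\<^sub>o F\<^sub>m. is_functor J C F\<^sub>o F\<^sub>m \<longrightarrow> (\<exists>L \<kappa>. is_colimit J C F\<^sub>o F\<^sub>m L \<kappa>))"

end

theory Submission
  imports Defs
begin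

text \<open>
  Call a map a cover if every map from an atom into its target lifts to its source after
  restriction along some map of atoms. Every map factors as a cover followed by a
  monomorphism, covers are epimorphisms, and a monic cover has a section. A cover
  \<open>q : X \<rightarrow> Q\<close> is controlled by its kernel, the set of those summands of the
  finite atomic decomposition of \<open>X \<times> X\<close> on which the two projections agree after \<open>q\<close>.
  For \<open>X\<close> the coproduct of all objects of the diagram, choose among the covers out of \<open>X\<close>
  that form a cocone one with the smallest kernel. Given any other cocone \<open>f : X \<rightarrow> T\<close>, the
  image \<open>Z\<close> of \<open>(q, f) : X \<rightarrow> Q \<times> T\<close> has the same kernel, so \<open>Z \<rightarrow> Q\<close> is a monic cover
  and \<open>f\<close> factors through \<open>q\<close>; the chosen quotient is therefore the colimit.
\<close>

section \<open>Arrow calculus, monomorphisms and coproducts in a category\<close>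

context category
begin

abbreviation comp (infixr "\<cdot>" 70) where
  "g \<cdot> f \<equiv> Comp C g f"

text \<open>The locale axioms about composition refer to objects that do not all occur in the terms
  being rewritten, so they are poor simplification rules. The arrow forms collected in
  \<open>cat_simps\<close> have conditions on \<open>Dom\<close> and \<open>Cod\<close> that the
  simplifier can discharge, and they bracket composites to the right.\<close>

lemma comp_arr:
  assumes "f \<in> Arr C" "g \<in> Arr C" "Cod C f = Dom C g"
  shows "g \<cdot> f \<in> Arr C" and "Dom C (g \<cdot> f) = Dom C f" and "Cod C (g \<cdot> f) = Cod C g"
  using Comp_in_Hom[of f "Dom C f" "Dom C g" g "Cod C g"] assms by (auto simp: Hom_def)

lemma comp_assoc:
  assumes "f \<in> Arr C" "g \<in> Arr C" "h \<in> Arr C" "Cod C f = Dom C g" "Cod C g = Dom C h"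
  shows "(h \<cdot> g) \<cdot> f = h \<cdot> g \<cdot> f"
  using Comp_assoc[of f "Dom C f" "Dom C g" g "Dom C h" h "Cod C h"] assms by (auto simp: Hom_def)

lemma idt_arr:
  assumes "X \<in> Obj C"
  shows "Idt C X \<in> Arr C" and "Dom C (Idt C X) = X" and "Cod C (Idt C X) = X"
  using Idt_in_Hom[OF assms] by (auto simp: Hom_def)

lemma comp_idt:
  assumes "f \<in> Arr C"
  shows "Cod C f = Y \<Longrightarrow> Idt C Y \<cdot> f = f" and "Dom C f = X \<Longrightarrow> f \<cdot> Idt C X = f"
  using Comp_Idt_left[of f] Comp_Idt_right[of f] assms by (auto simp: Hom_def)

lemmas cat_simps = Hom_def comp_arr comp_assoc idt_arr comp_idt

lemma Hom_Obj:
  assumes "f \<in> Hom C X Y"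
  shows "X \<in> Obj C" and "Y \<in> Obj C"
  using assms Dom_in_Obj Cod_in_Obj by (auto simp: Hom_def)

lemma mono_cancel:
  assumes "is_mono C X Y f" "g \<in> Hom C W X" "h \<in> Hom C W X" "f \<cdot> g = f \<cdot> h"
  shows "g = h"
  using assms Hom_Obj(1)[OF assms(2)] unfolding is_mono_def by blast

lemma mono_Hom: "is_mono C X Y f \<Longrightarrow> f \<in> Hom C X Y"
  by (simp add: is_mono_def)

lemma mono_comp:
  assumes "is_mono C X Y f" "is_mono C Y Z g"
  shows "is_mono C X Z (g \<cdot> f)"
  unfolding is_mono_def
proof (intro conjI ballI impI)
  have f: "f \<in> Hom C X Y" and g: "g \<in> Hom C Y Z"
    using assms by (auto simp: is_mono_def)
  show "g \<cdot> f \<in> Hom C X Z"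
    using f g by (rule Comp_in_Hom)
  fix W u v
  assume u: "u \<in> Hom C W X" and v: "v \<in> Hom C W X" and "(g \<cdot> f) \<cdot> u = (g \<cdot> f) \<cdot> v"
  then have "g \<cdot> (f \<cdot> u) = g \<cdot> (f \<cdot> v)"
    using f g by (simp add: cat_simps)
  then have "f \<cdot> u = f \<cdot> v"
    using mono_cancel[OF assms(2)] Comp_in_Hom u v f by blast
  then show "u = v"
    using mono_cancel[OF assms(1) u v] by blast
qed

lemma coproduct_inj_Hom: "is_coproduct C I A W \<iota> \<Longrightarrow> i \<in> I \<Longrightarrow> \<iota> i \<in> Hom C (A i) W"
  by (simp add: is_coproduct_def)

lemma coproduct_desc:
  assumes "is_coproduct C I A W \<iota>" "T \<in> Obj C" "\<And>i. i \<in> I \<Longrightarrow> f i \<in> Hom C (A i) T"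
  obtains h where "h \<in> Hom C W T" "\<And>i. i \<in> I \<Longrightarrow> h \<cdot> \<iota> i = f i"
  using assms unfolding is_coproduct_def by metis

lemma coproduct_ext:
  assumes W: "is_coproduct C I A W \<iota>" and g: "g \<in> Hom C W T" and h: "h \<in> Hom C W T"
    and eq: "\<And>i. i \<in> I \<Longrightarrow> g \<cdot> \<iota> i = h \<cdot> \<iota> i"
  shows "g = h"
proof -
  have "\<forall>i\<in>I. g \<cdot> \<iota> i \<in> Hom C (A i) T"
    using Comp_in_Hom[OF _ g] W by (auto simp: is_coproduct_def)
  then have "\<exists>!k. k \<in> Hom C W T \<and> (\<forall>i\<in>I. k \<cdot> \<iota> i = g \<cdot> \<iota> i)"
    using W Hom_Obj(2)[OF g] by (simp add: is_coproduct_def)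
  then show ?thesis
    using g h eq by metis
qed

lemma coproduct_empty_initial:
  assumes "is_coproduct C {} A W \<iota>"
  shows "is_initial C W"
  using assms by (simp add: is_coproduct_def is_initial_def)

text \<open>The decomposition axiom yields a coproduct of atoms that is merely isomorphic to the
  given object. Composing the injections with the inverse isomorphism makes the object itself such a
  coproduct.\<close>

lemma coproduct_iso:
  assumes W: "is_coproduct C I A W \<iota>" and f: "is_iso C X W f"
  obtains \<kappa> where "is_coproduct C I A X \<kappa>"
proof -
  obtain g where g: "g \<in> Hom C W X" and gf: "g \<cdot> f = Idt C X" and fg: "f \<cdot> g = Idt C W"
    and fH: "f \<in> Hom C X W"
    using f by (auto simp: is_iso_def)
  have "is_coproduct C I A X (\<lambda>i. g \<cdot> \<iota> i)"
    unfolding is_coproduct_def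
  proof (intro conjI ballI allI impI)
    show "X \<in> Obj C"
      using Hom_Obj fH by blast
    show "g \<cdot> \<iota> i \<in> Hom C (A i) X" if "i \<in> I" for i
      using coproduct_inj_Hom[OF W that] g by (rule Comp_in_Hom)
    fix T k
    assume T: "T \<in> Obj C" and k: "\<forall>i\<in>I. k i \<in> Hom C (A i) T"
    obtain h where h: "h \<in> Hom C W T" and hk: "\<And>i. i \<in> I \<Longrightarrow> h \<cdot> \<iota> i = k i"
      using coproduct_desc[OF W T, of k] k by blast
    show "\<exists>!h. h \<in> Hom C X T \<and> (\<forall>i\<in>I. h \<cdot> g \<cdot> \<iota> i = k i)"
    proof (rule ex1I[of _ "h \<cdot> f"], intro conjI ballI)
      show "h \<cdot> f \<in> Hom C X T"
        using fH h by (rule Comp_in_Hom)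
      fix i assume i: "i \<in> I"
      have "(h \<cdot> f) \<cdot> g \<cdot> \<iota> i = h \<cdot> (f \<cdot> g) \<cdot> \<iota> i"
        using coproduct_inj_Hom[OF W i] fH g h by (simp add: cat_simps)
      then show "(h \<cdot> f) \<cdot> g \<cdot> \<iota> i = k i"
        using coproduct_inj_Hom[OF W i] hk[OF i] fg by (simp add: cat_simps)
    next
      fix h'
      assume "h' \<in> Hom C X T \<and> (\<forall>i\<in>I. h' \<cdot> g \<cdot> \<iota> i = k i)"
      then have h': "h' \<in> Hom C X T" and h'k: "\<And>i. i \<in> I \<Longrightarrow> h' \<cdot> g \<cdot> \<iota> i = k i"
        by auto
      have "h' \<cdot> g = h"
      proof (rule coproduct_ext[OF W Comp_in_Hom[OF g h'] h])
        fix i assume i: "i \<in> I"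
        then show "(h' \<cdot> g) \<cdot> \<iota> i = h \<cdot> \<iota> i"
          using coproduct_inj_Hom[OF W i] g h' h'k[OF i] hk[OF i] by (simp add: cat_simps)
      qed
      then have "h \<cdot> f = h' \<cdot> (g \<cdot> f)"
        using fH g h' by (auto simp: cat_simps)
      then show "h' = h \<cdot> f"
        using gf h' by (simp add: cat_simps)
    qed
  qed
  then show ?thesis
    by (rule that)
qed

text \<open>The coproduct axiom speaks of index sets \<open>{..<n}\<close>; this carries it over to
  arbitrary finite index sets such as \<open>Obj J\<close>.\<close>

lemma coproduct_reindex:
  assumes h: "bij_betw h I K" and W: "is_coproduct C K (\<lambda>k. A (inv_into I h k)) W \<iota>"
  shows "is_coproduct C I A W (\<lambda>i. \<iota> (h i))"
  unfolding is_coproduct_def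
proof (intro conjI ballI allI impI)
  have inv: "inv_into I h (h i) = i" "h i \<in> K" if "i \<in> I" for i
    using h that by (auto simp: bij_betw_def)
  have K: "K = h ` I"
    using h by (simp add: bij_betw_def)
  show "W \<in> Obj C"
    using W by (simp add: is_coproduct_def)
  show "\<iota> (h i) \<in> Hom C (A i) W" if "i \<in> I" for i
    using coproduct_inj_Hom[OF W inv(2)[OF that]] inv(1)[OF that] by simp
  fix T k
  assume T: "T \<in> Obj C" and k: "\<forall>i\<in>I. k i \<in> Hom C (A i) T"
  have "\<forall>j\<in>K. k (inv_into I h j) \<in> Hom C (A (inv_into I h j)) T"
    using k by (simp add: K inv_into_into)
  then have "\<exists>!g. g \<in> Hom C W T \<and> (\<forall>j\<in>K. g \<cdot> \<iota> j = k (inv_into I h j))"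
    using W T by (simp add: is_coproduct_def)
  moreover have "(\<forall>j\<in>K. g \<cdot> \<iota> j = k (inv_into I h j)) \<longleftrightarrow> (\<forall>i\<in>I. g \<cdot> \<iota> (h i) = k i)" for g
    using inv by (auto simp: K)
  ultimately show "\<exists>!g. g \<in> Hom C W T \<and> (\<forall>i\<in>I. g \<cdot> \<iota> (h i) = k i)"
    by simp
qed

text \<open>Splitting off one summand makes the binary axiom \<open>Hom_atom_coproduct\<close>
  applicable to finite coproducts.\<close>

lemma coproduct_insert:
  assumes k: "k \<notin> I" and W: "is_coproduct C (insert k I) A W \<iota>" and V: "is_coproduct C I A V \<kappa>"
  obtains m where "is_coproduct2 C V (A k) W m (\<iota> k)" "\<And>i. i \<in> I \<Longrightarrow> m \<cdot> \<kappa> i = \<iota> i"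
proof -
  have W_Obj: "W \<in> Obj C" and V_Obj: "V \<in> Obj C"
    using W V by (auto simp: is_coproduct_def)
  have \<iota>: "\<And>i. i \<in> insert k I \<Longrightarrow> \<iota> i \<in> Hom C (A i) W"
    using coproduct_inj_Hom[OF W] .
  obtain m where m: "m \<in> Hom C V W" and m\<kappa>: "\<And>i. i \<in> I \<Longrightarrow> m \<cdot> \<kappa> i = \<iota> i"
    using coproduct_desc[OF V W_Obj, of \<iota>] \<iota> by blast
  \<comment> \<open>An equation on \<open>V\<close> is the same as a family of equations on the
    summands indexed by \<open>I\<close>, so the binary universal property is a regrouping of the
    one of \<open>W\<close>.\<close>
  have m_ext: "(h \<cdot> m = f) \<longleftrightarrow> (\<forall>i\<in>I. h \<cdot> \<iota> i = f \<cdot> \<kappa> i)"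
    if h: "h \<in> Hom C W T" and f: "f \<in> Hom C V T" for h f T
  proof -
    have *: "(h \<cdot> m) \<cdot> \<kappa> i = h \<cdot> \<iota> i" if "i \<in> I" for i
      using coproduct_inj_Hom[OF V that] m h m\<kappa>[OF that] by (simp add: cat_simps)
    then show ?thesis
      using coproduct_ext[OF V Comp_in_Hom[OF m h] f] by auto
  qed
  have "is_coproduct2 C V (A k) W m (\<iota> k)"
    unfolding is_coproduct2_def
  proof (intro conjI ballI W_Obj m)
    show "\<iota> k \<in> Hom C (A k) W"
      using \<iota> by simp
    fix T f g
    assume T: "T \<in> Obj C" and f: "f \<in> Hom C V T" and g: "g \<in> Hom C (A k) T"
    define d where "d i = (if i = k then g else f \<cdot> \<kappa> i)" for i
    have "\<forall>i\<in>insert k I. d i \<in> Hom C (A i) T"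
      using g Comp_in_Hom[OF coproduct_inj_Hom[OF V] f] by (simp add: d_def)
    then have "\<exists>!h. h \<in> Hom C W T \<and> (\<forall>i\<in>insert k I. h \<cdot> \<iota> i = d i)"
      using W T by (simp add: is_coproduct_def)
    moreover have "h \<in> Hom C W T \<and> (\<forall>i\<in>insert k I. h \<cdot> \<iota> i = d i) \<longleftrightarrow>
        h \<in> Hom C W T \<and> h \<cdot> m = f \<and> h \<cdot> \<iota> k = g" for h
      using m_ext[OF _ f, of h] k by (auto simp: d_def)
    ultimately show "\<exists>!h. h \<in> Hom C W T \<and> h \<cdot> m = f \<and> h \<cdot> \<iota> k = g"
      by simp
  qed
  then show ?thesis
    using m\<kappa> by (rule that)
qed

section \<open>Covers, a local form of surjectivity tested on atoms\<close>

definition is_cover :: "'o \<Rightarrow> 'o \<Rightarrow> 'm \<Rightarrow> bool" where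
  "is_cover X Y f \<longleftrightarrow> f \<in> Hom C X Y \<and>
     (\<forall>A a. is_atom C A \<and> a \<in> Hom C A Y \<longrightarrow>
        (\<exists>B \<beta> b. is_atom C B \<and> \<beta> \<in> Hom C B A \<and> b \<in> Hom C B X \<and> f \<cdot> b = a \<cdot> \<beta>))"

lemma cover_lift:
  assumes "is_cover X Y f" "is_atom C A" "a \<in> Hom C A Y"
  obtains B \<beta> b where "is_atom C B" "\<beta> \<in> Hom C B A" "b \<in> Hom C B X" "f \<cdot> b = a \<cdot> \<beta>"
  using assms unfolding is_cover_def by blast

lemma cover_Hom: "is_cover X Y f \<Longrightarrow> f \<in> Hom C X Y"
  by (simp add: is_cover_def)

lemma cover_of_comp:
  assumes c: "is_cover X Z (g \<cdot> f)" and f: "f \<in> Hom C X Y" and g: "g \<in> Hom C Y Z"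
  shows "is_cover Y Z g"
  unfolding is_cover_def
proof (intro conjI allI impI g)
  fix A a
  assume "is_atom C A \<and> a \<in> Hom C A Z"
  then obtain B \<beta> b where B: "is_atom C B" "\<beta> \<in> Hom C B A" and b: "b \<in> Hom C B X"
    and eq: "(g \<cdot> f) \<cdot> b = a \<cdot> \<beta>"
    using cover_lift[OF c] by metis
  have "g \<cdot> (f \<cdot> b) = a \<cdot> \<beta>"
    using eq f g b by (simp add: cat_simps)
  then show "\<exists>B \<beta> b. is_atom C B \<and> \<beta> \<in> Hom C B A \<and> b \<in> Hom C B Y \<and> g \<cdot> b = a \<cdot> \<beta>"
    using B Comp_in_Hom[OF b f] by blast
qed

end

section \<open>Maps from atoms into finite coproducts\<close>

context B_category
begin

lemma finite_coproduct_exists: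
  assumes "finite I" "\<And>i. i \<in> I \<Longrightarrow> A i \<in> Obj C"
  obtains W \<iota> where "is_coproduct C I A W \<iota>"
proof -
  obtain h where h: "bij_betw h I {..<card I}"
    using ex_bij_betw_finite_nat[OF assms(1)] by (auto simp: atLeast0LessThan)
  have "A (inv_into I h k) \<in> Obj C" if "k < card I" for k
    using that h by (intro assms(2) inv_into_into) (auto simp: bij_betw_def)
  then obtain W \<iota> where "is_coproduct C {..<card I} (\<lambda>k. A (inv_into I h k)) W \<iota>"
    using finite_coproducts[of "card I" "\<lambda>k. A (inv_into I h k)"] by blast
  then show ?thesis
    using coproduct_reindex[OF h] that by blast
qed

lemma decomposition:
  assumes "X \<in> Obj C"
  obtains n :: nat and A \<iota> where "\<And>i. i < n \<Longrightarrow> is_atom C (A i)" "is_coproduct C {..<n} A X \<iota>"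
  using atomic_decomposition[OF assms] coproduct_iso unfolding isomorphic_def by metis

text \<open>Since \<open>0 \<amalg> 0 = 0\<close>, a map from an atom to \<open>0\<close> would factor through both summands.\<close>

lemma no_Hom_atom_initial:
  assumes X: "is_atom C X" and I: "is_initial C I"
  shows "Hom C X I = {}"
proof -
  have I_Obj: "I \<in> Obj C"
    using I by (simp add: is_initial_def)
  have "is_coproduct2 C I I I (Idt C I) (Idt C I)"
    unfolding is_coproduct2_def
  proof (intro conjI ballI)
    fix T f g
    assume "T \<in> Obj C" "f \<in> Hom C I T" "g \<in> Hom C I T"
    then have "g = f" and "f \<in> Hom C I T"
      using I by (auto simp: is_initial_def)
    then show "\<exists>!h. h \<in> Hom C I T \<and> h \<cdot> Idt C I = f \<and> h \<cdot> Idt C I = g"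
      by (intro ex1I[of _ f]) (auto simp: cat_simps)
  qed (use I_Obj Idt_in_Hom in auto)
  from Hom_atom_coproduct[OF X I_Obj I_Obj this]
  have inj: "inj_on (case_sum (Comp C (Idt C I)) (Comp C (Idt C I))) (Hom C X I <+> Hom C X I)"
    by (simp add: bij_betw_def)
  show ?thesis
  proof (rule equals0I)
    fix a assume "a \<in> Hom C X I"
    then have "Inl a \<in> Hom C X I <+> Hom C X I" "Inr a \<in> Hom C X I <+> Hom C X I"
      by auto
    from inj_onD[OF inj _ this] show False
      by simp
  qed
qed

lemma no_Hom_atom_empty:
  assumes X: "is_atom C X" and a: "a \<in> Hom C X E"
  shows "\<not> is_empty_obj C E"
proof
  assume "is_empty_obj C E"
  then obtain I f where "is_initial C I" "f \<in> Hom C E I"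
    by (auto simp: is_empty_obj_def isomorphic_def is_iso_def)
  then show False
    using no_Hom_atom_initial[OF X] Comp_in_Hom[OF a] by blast
qed

text \<open>This is the surjective half of \<open>Hom_atom_coproduct\<close>; the injective half
  follows in \<open>atom_inj_coproduct2\<close>.\<close>

lemma atom_factors_coproduct2:
  assumes X: "is_atom C X" and W: "is_coproduct2 C Y Z W i j" and a: "a \<in> Hom C X W"
  shows "(\<exists>b \<in> Hom C X Y. a = i \<cdot> b) \<or> (\<exists>b \<in> Hom C X Z. a = j \<cdot> b)"
proof -
  have "Y \<in> Obj C" "Z \<in> Obj C"
    using W Hom_Obj by (auto simp: is_coproduct2_def)
  from Hom_atom_coproduct[OF X this W]
  have "a \<in> case_sum (Comp C i) (Comp C j) ` (Hom C X Y <+> Hom C X Z)"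
    using a by (simp add: bij_betw_def)
  then show ?thesis
    by auto
qed

lemma atom_inj_coproduct2:
  assumes X: "is_atom C X" and W: "is_coproduct2 C Y Z W i j"
  shows "b \<in> Hom C X Y \<Longrightarrow> c \<in> Hom C X Z \<Longrightarrow> i \<cdot> b \<noteq> j \<cdot> c"
    and "c \<in> Hom C X Z \<Longrightarrow> c' \<in> Hom C X Z \<Longrightarrow> j \<cdot> c = j \<cdot> c' \<Longrightarrow> c = c'"
proof -
  have "Y \<in> Obj C" "Z \<in> Obj C"
    using W Hom_Obj by (auto simp: is_coproduct2_def)
  from Hom_atom_coproduct[OF X this W]
  have inj: "inj_on (case_sum (Comp C i) (Comp C j)) (Hom C X Y <+> Hom C X Z)"
    by (simp add: bij_betw_def)
  show "b \<in> Hom C X Y \<Longrightarrow> c \<in> Hom C X Z \<Longrightarrow> i \<cdot> b \<noteq> j \<cdot> c"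
    using inj_onD[OF inj, of "Inl b" "Inr c"] by auto
  show "c \<in> Hom C X Z \<Longrightarrow> c' \<in> Hom C X Z \<Longrightarrow> j \<cdot> c = j \<cdot> c' \<Longrightarrow> c = c'"
    using inj_onD[OF inj, of "Inr c" "Inr c'"] by auto
qed

text \<open>By induction on the index set. The empty coproduct is initial and receives no map from
  an atom; otherwise one summand is split off and the binary case applies.\<close>

lemma atom_factors_coproduct:
  assumes "finite I" and X: "is_atom C X"
    and "is_coproduct C I A W \<iota>" "a \<in> Hom C X W"
  shows "\<exists>i \<in> I. \<exists>b \<in> Hom C X (A i). a = \<iota> i \<cdot> b"
  using assms(1,3,4)
proof (induction I arbitrary: W \<iota> a)
  case empty
  then show ?case
    using no_Hom_atom_initial[OF X coproduct_empty_initial] by blast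
next
  case (insert k I)
  have "A i \<in> Obj C" if "i \<in> I" for i
    using Hom_Obj(1)[OF coproduct_inj_Hom[OF insert.prems(1)]] that by blast
  then obtain V \<kappa> where V: "is_coproduct C I A V \<kappa>"
    using finite_coproduct_exists[OF insert.hyps(1)] by metis
  obtain m where m: "is_coproduct2 C V (A k) W m (\<iota> k)" and m\<kappa>: "\<And>i. i \<in> I \<Longrightarrow> m \<cdot> \<kappa> i = \<iota> i"
    using coproduct_insert[OF insert.hyps(2) insert.prems(1) V] by metis
  from atom_factors_coproduct2[OF X m insert.prems(2)] show ?case
  proof
    assume "\<exists>b \<in> Hom C X V. a = m \<cdot> b"
    then obtain b where b: "b \<in> Hom C X V" "a = m \<cdot> b" by blast
    obtain i c where i: "i \<in> I" and c: "c \<in> Hom C X (A i)" and bc: "b = \<kappa> i \<cdot> c"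
      using insert.IH[OF V b(1)] by blast
    have "m \<in> Hom C V W"
      using m by (simp add: is_coproduct2_def)
    then have "a = (m \<cdot> \<kappa> i) \<cdot> c"
      using b(2) bc c coproduct_inj_Hom[OF V i] by (simp add: cat_simps)
    then show ?thesis
      using i c m\<kappa>[OF i] by auto
  qed auto
qed

text \<open>Split off the summand \<open>i\<close>. A map through another summand \<open>j\<close>
  would pass through the complement \<open>V\<close>, which the disjointness in the binary case
  forbids; once \<open>i = j\<close>, the injection can be cancelled.\<close>

lemma atom_inj_coproduct:
  assumes fin: "finite I" and X: "is_atom C X" and W: "is_coproduct C I A W \<iota>"
    and i: "i \<in> I" and j: "j \<in> I" and b: "b \<in> Hom C X (A i)" and c: "c \<in> Hom C X (A j)"
    and eq: "\<iota> i \<cdot> b = \<iota> j \<cdot> c"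
  shows "i = j \<and> b = c"
proof -
  have "A k \<in> Obj C" if "k \<in> I - {i}" for k
    using Hom_Obj(1)[OF coproduct_inj_Hom[OF W]] that by blast
  then obtain V \<kappa> where V: "is_coproduct C (I - {i}) A V \<kappa>"
    using finite_coproduct_exists[of "I - {i}" A] fin by auto
  have "is_coproduct C (insert i (I - {i})) A W \<iota>"
    using W i by (simp add: insert_absorb)
  then obtain m where m: "is_coproduct2 C V (A i) W m (\<iota> i)"
    and m\<kappa>: "\<And>k. k \<in> I - {i} \<Longrightarrow> m \<cdot> \<kappa> k = \<iota> k"
    using coproduct_insert[OF _ _ V, of i W \<iota>] by auto
  have "i = j"
  proof (rule ccontr)
    assume "i \<noteq> j"
    then have j': "j \<in> I - {i}" using j by simp
    have "m \<in> Hom C V W"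
      using m by (simp add: is_coproduct2_def)
    then have "m \<cdot> (\<kappa> j \<cdot> c) = (m \<cdot> \<kappa> j) \<cdot> c"
      using c coproduct_inj_Hom[OF V j'] by (simp add: cat_simps)
    then have "m \<cdot> (\<kappa> j \<cdot> c) = \<iota> i \<cdot> b"
      using m\<kappa>[OF j'] eq by simp
    then show False
      using atom_inj_coproduct2(1)[OF X m Comp_in_Hom[OF c coproduct_inj_Hom[OF V j']] b] by blast
  qed
  then show ?thesis
    using atom_inj_coproduct2(2)[OF X m] b c eq by blast
qed

text \<open>Every object is a coproduct of atoms, and the injections are among the maps
  \<open>a\<close>. Atoms thus play the role of points when equations are tested.\<close>

lemma atoms_jointly_epic:
  assumes g: "g \<in> Hom C W T" and h: "h \<in> Hom C W T"
    and eq: "\<And>A a. is_atom C A \<Longrightarrow> a \<in> Hom C A W \<Longrightarrow> g \<cdot> a = h \<cdot> a"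
  shows "g = h"
proof -
  obtain n :: nat and A \<iota> where A: "\<And>i. i < n \<Longrightarrow> is_atom C (A i)"
    and W: "is_coproduct C {..<n} A W \<iota>"
    using decomposition[OF Hom_Obj(1)[OF g]] by metis
  show ?thesis
    by (rule coproduct_ext[OF W g h]) (use eq A coproduct_inj_Hom[OF W] in auto)
qed

lemma mono_if_atoms:
  assumes f: "f \<in> Hom C X Y"
    and inj: "\<And>A a b. is_atom C A \<Longrightarrow> a \<in> Hom C A X \<Longrightarrow> b \<in> Hom C A X \<Longrightarrow> f \<cdot> a = f \<cdot> b \<Longrightarrow> a = b"
  shows "is_mono C X Y f"
  unfolding is_mono_def
proof (intro conjI ballI impI f)
  fix W g h
  assume g: "g \<in> Hom C W X" and h: "h \<in> Hom C W X" and eq: "f \<cdot> g = f \<cdot> h"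
  show "g = h"
  proof (rule atoms_jointly_epic[OF g h])
    fix A a assume A: "is_atom C A" and a: "a \<in> Hom C A W"
    have "f \<cdot> (g \<cdot> a) = (f \<cdot> g) \<cdot> a"
      using f g a by (simp add: cat_simps)
    also have "\<dots> = f \<cdot> (h \<cdot> a)"
      unfolding eq using f h a by (simp add: cat_simps)
    finally show "g \<cdot> a = h \<cdot> a"
      using inj[OF A Comp_in_Hom[OF a g] Comp_in_Hom[OF a h]] by blast
  qed
qed

text \<open>A non-empty object has at least one atomic summand, and the injection of a summand is
  monic by \<open>atom_inj_coproduct\<close>. Monicity matters because it allows
  \<open>mono_atoms_iso\<close> to be applied later to composites with the inclusion.\<close>

lemma nonempty_has_atom:
  assumes X: "X \<in> Obj C" and ne: "\<not> is_empty_obj C X"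
  obtains A a where "is_atom C A" "is_mono C A X a"
proof -
  obtain n :: nat and A \<iota> where A: "\<And>i. i < n \<Longrightarrow> is_atom C (A i)"
    and W: "is_coproduct C {..<n} A X \<iota>"
    using decomposition[OF X] by metis
  have "n \<noteq> 0"
  proof
    assume "n = 0"
    then have "is_initial C X"
      using W coproduct_empty_initial by simp
    moreover have "is_iso C X X (Idt C X)"
      using X by (auto simp: is_iso_def cat_simps)
    ultimately show False
      using ne X by (auto simp: is_empty_obj_def isomorphic_def)
  qed
  then have 0: "0 \<in> {..<n}" by simp
  have "is_mono C (A 0) X (\<iota> 0)"
  proof (rule mono_if_atoms[OF coproduct_inj_Hom[OF W 0]])
    fix B a b
    assume "is_atom C B" "a \<in> Hom C B (A 0)" "b \<in> Hom C B (A 0)" "\<iota> 0 \<cdot> a = \<iota> 0 \<cdot> b"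
    then show "a = b"
      using atom_inj_coproduct[OF _ _ W 0 0] by blast
  qed
  then show ?thesis
    using A \<open>n \<noteq> 0\<close> that by blast
qed

section \<open>Products, equalizers, and epimorphisms obtained from atoms\<close>

lemma product_exists:
  assumes "X \<in> Obj C" "Y \<in> Obj C"
  obtains P p q where "p \<in> Hom C P X" "q \<in> Hom C P Y"
    "\<And>T u v. u \<in> Hom C T X \<Longrightarrow> v \<in> Hom C T Y \<Longrightarrow> \<exists>!h. h \<in> Hom C T P \<and> p \<cdot> h = u \<and> q \<cdot> h = v"
proof -
  obtain F where F: "is_final C F"
    using final_object by blast
  then obtain x y where x: "x \<in> Hom C X F" and y: "y \<in> Hom C Y F"
    using assms unfolding is_final_def by blast
  obtain P p q where P: "is_fiber_product C X Y x y P p q"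
    using fiber_products[OF x y] by blast
  show ?thesis
  proof
    show "p \<in> Hom C P X" "q \<in> Hom C P Y"
      using P by (auto simp: is_fiber_product_def)
    fix T u v
    assume u: "u \<in> Hom C T X" and v: "v \<in> Hom C T Y"
    have "x \<cdot> u = y \<cdot> v"
      using F Comp_in_Hom[OF u x] Comp_in_Hom[OF v y] Hom_Obj(1)[OF u]
      unfolding is_final_def by blast
    then show "\<exists>!h. h \<in> Hom C T P \<and> p \<cdot> h = u \<and> q \<cdot> h = v"
      using P u v Hom_Obj(1)[OF u] unfolding is_fiber_product_def by blast
  qed
qed

text \<open>The equalizer is the pullback of the diagonal \<open>\<delta>\<close> of
  \<open>T\<close> along the map \<open>k\<close> into the product \<open>P\<close> of
  \<open>T\<close> with itself whose components are \<open>u\<close> and \<open>v\<close>.\<close>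

lemma equalizer_exists:
  assumes u: "u \<in> Hom C A T" and v: "v \<in> Hom C A T"
  obtains E e where "is_mono C E A e" "u \<cdot> e = v \<cdot> e"
    "\<And>W b. b \<in> Hom C W A \<Longrightarrow> u \<cdot> b = v \<cdot> b \<Longrightarrow> \<exists>c \<in> Hom C W E. e \<cdot> c = b"
proof -
  have T: "T \<in> Obj C"
    using Hom_Obj(2)[OF u] .
  obtain P p q where p: "p \<in> Hom C P T" and q: "q \<in> Hom C P T"
    and P: "\<And>W u v. u \<in> Hom C W T \<Longrightarrow> v \<in> Hom C W T \<Longrightarrow>
      \<exists>!h. h \<in> Hom C W P \<and> p \<cdot> h = u \<and> q \<cdot> h = v"
    by (rule product_exists[OF T T], rule that)
  obtain k where k: "k \<in> Hom C A P" and pk: "p \<cdot> k = u" and qk: "q \<cdot> k = v"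
    using P[OF u v] by blast
  have idT: "Idt C T \<in> Hom C T T"
    using Idt_in_Hom[OF T] .
  obtain \<delta> where \<delta>: "\<delta> \<in> Hom C T P" and p\<delta>: "p \<cdot> \<delta> = Idt C T" and q\<delta>: "q \<cdot> \<delta> = Idt C T"
    using P[OF idT idT] by blast
  obtain E e d where E: "is_fiber_product C A T k \<delta> E e d"
    using fiber_products[OF k \<delta>] by blast
  have e: "e \<in> Hom C E A" and d: "d \<in> Hom C E T" and kd: "k \<cdot> e = \<delta> \<cdot> d"
    and uni: "\<And>W b t. b \<in> Hom C W A \<Longrightarrow> t \<in> Hom C W T \<Longrightarrow> k \<cdot> b = \<delta> \<cdot> t \<Longrightarrow>
      \<exists>!h. h \<in> Hom C W E \<and> e \<cdot> h = b \<and> d \<cdot> h = t"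
    using E Hom_Obj(1) by (simp_all add: is_fiber_product_def)
  have ue: "u \<cdot> e = d"
  proof -
    have "u \<cdot> e = p \<cdot> (k \<cdot> e)"
      unfolding pk[symmetric] using p k e by (simp add: cat_simps)
    also have "\<dots> = (p \<cdot> \<delta>) \<cdot> d"
      unfolding kd using p \<delta> d by (simp add: cat_simps)
    finally show ?thesis
      using p\<delta> d by (simp add: cat_simps)
  qed
  have ve: "v \<cdot> e = d"
  proof -
    have "v \<cdot> e = q \<cdot> (k \<cdot> e)"
      unfolding qk[symmetric] using q k e by (simp add: cat_simps)
    also have "\<dots> = (q \<cdot> \<delta>) \<cdot> d"
      unfolding kd using q \<delta> d by (simp add: cat_simps)
    finally show ?thesis
      using q\<delta> d by (simp add: cat_simps)
  qed
  show ?thesis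
  proof
    show "u \<cdot> e = v \<cdot> e"
      using ue ve by simp
    show "is_mono C E A e"
      unfolding is_mono_def
    proof (intro conjI ballI impI e)
      fix W g h
      assume g: "g \<in> Hom C W E" and h: "h \<in> Hom C W E" and eq: "e \<cdot> g = e \<cdot> h"
      \<comment> \<open>The second projection is determined by the first, so agreement after
        \<open>e\<close> alone suffices for uniqueness in the pullback.\<close>
      have dg: "d \<cdot> x = u \<cdot> (e \<cdot> x)" if "x \<in> Hom C W E" for x
        unfolding ue[symmetric] using u e that by (simp add: cat_simps)
      have "k \<cdot> (e \<cdot> g) = (k \<cdot> e) \<cdot> g"
        using k e g by (simp add: cat_simps)
      also have "\<dots> = \<delta> \<cdot> (d \<cdot> g)"
        unfolding kd using \<delta> d g by (simp add: cat_simps)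
      finally have "\<exists>!x. x \<in> Hom C W E \<and> e \<cdot> x = e \<cdot> g \<and> d \<cdot> x = d \<cdot> g"
        using uni[OF Comp_in_Hom[OF g e] Comp_in_Hom[OF g d]] by blast
      then show "g = h"
        using g h eq dg by metis
    qed
    fix W b
    assume b: "b \<in> Hom C W A" and eq: "u \<cdot> b = v \<cdot> b"
    have ub: "u \<cdot> b \<in> Hom C W T"
      using b u by (rule Comp_in_Hom)
    have "p \<cdot> k \<cdot> b = u \<cdot> b" "q \<cdot> k \<cdot> b = u \<cdot> b"
      using Comp_assoc[OF b k p] Comp_assoc[OF b k q] pk qk eq by simp_all
    moreover have "p \<cdot> \<delta> \<cdot> u \<cdot> b = u \<cdot> b" "q \<cdot> \<delta> \<cdot> u \<cdot> b = u \<cdot> b"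
      using Comp_assoc[OF ub \<delta> p] Comp_assoc[OF ub \<delta> q] p\<delta> q\<delta> Comp_Idt_left[OF ub]
      by simp_all
    ultimately have "k \<cdot> b = \<delta> \<cdot> u \<cdot> b"
      using P[OF ub ub] Comp_in_Hom[OF b k] Comp_in_Hom[OF ub \<delta>] by blast
    then show "\<exists>c \<in> Hom C W E. e \<cdot> c = b"
      using uni[OF b ub] by blast
  qed
qed

text \<open>The map \<open>\<beta>\<close> factors through the equalizer \<open>E\<close> of
  \<open>u\<close> and \<open>v\<close>, so \<open>E\<close> is non-empty and contains an atom
  \<open>D\<close>. The composite of \<open>D\<close> into \<open>A\<close> is a monomorphism of
  atoms, hence an isomorphism; thus \<open>E\<close> already covers all of \<open>A\<close>.\<close>

lemma atom_map_epi:
  assumes A: "is_atom C A" and B: "is_atom C B" and \<beta>: "\<beta> \<in> Hom C B A"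
    and u: "u \<in> Hom C A T" and v: "v \<in> Hom C A T" and eq: "u \<cdot> \<beta> = v \<cdot> \<beta>"
  shows "u = v"
proof -
  obtain E e where e: "is_mono C E A e" and ue: "u \<cdot> e = v \<cdot> e"
    and uni: "\<And>W b. b \<in> Hom C W A \<Longrightarrow> u \<cdot> b = v \<cdot> b \<Longrightarrow> \<exists>c \<in> Hom C W E. e \<cdot> c = b"
    using equalizer_exists[OF u v] by metis
  obtain c where c: "c \<in> Hom C B E"
    using uni[OF \<beta> eq] by blast
  obtain D d where D: "is_atom C D" and d: "is_mono C D E d"
    using nonempty_has_atom[OF Hom_Obj(2)[OF c] no_Hom_atom_empty[OF B c]] by blast
  have "is_iso C D A (e \<cdot> d)"
    using mono_atoms_iso[OF D A mono_comp[OF d e]] .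
  then obtain s where s: "s \<in> Hom C A D" and ed: "(e \<cdot> d) \<cdot> s = Idt C A"
    by (auto simp: is_iso_def)
  have "x = (x \<cdot> e) \<cdot> d \<cdot> s" if "x \<in> Hom C A T" for x
  proof -
    have "(x \<cdot> e) \<cdot> d \<cdot> s = x \<cdot> (e \<cdot> d) \<cdot> s"
      using that mono_Hom[OF e] mono_Hom[OF d] s by (simp add: cat_simps)
    then show ?thesis
      unfolding ed using that by (simp add: cat_simps)
  qed
  then show ?thesis
    using u v ue by metis
qed

text \<open>On each atom of \<open>Y\<close> the two maps agree after a refinement
  \<open>\<beta>\<close>, which can be cancelled because maps of atoms are epimorphisms.\<close>

lemma cover_epi:
  assumes f: "is_cover X Y f" and u: "u \<in> Hom C Y T" and v: "v \<in> Hom C Y T"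
    and eq: "u \<cdot> f = v \<cdot> f"
  shows "u = v"
proof (rule atoms_jointly_epic[OF u v])
  fix A a assume A: "is_atom C A" and a: "a \<in> Hom C A Y"
  obtain B \<beta> b where B: "is_atom C B" and \<beta>: "\<beta> \<in> Hom C B A" and b: "b \<in> Hom C B X"
    and fb: "f \<cdot> b = a \<cdot> \<beta>"
    using cover_lift[OF f A a] by metis
  have *: "(x \<cdot> a) \<cdot> \<beta> = (x \<cdot> f) \<cdot> b" if "x \<in> Hom C Y T" for x
    using Comp_assoc[OF b cover_Hom[OF f] that] Comp_assoc[OF \<beta> a that] fb by simp
  show "u \<cdot> a = v \<cdot> a"
    by (rule atom_map_epi[OF A B \<beta> Comp_in_Hom[OF a u] Comp_in_Hom[OF a v]])
      (simp add: * u v eq)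
qed

text \<open>The section is built on one atomic summand of \<open>Q\<close> at a time. The pullback
  of \<open>f\<close> to a summand is a non-empty subobject of an atom, so an atom inside it maps
  isomorphically to the summand, and the inverse gives the section there.\<close>

lemma mono_cover_section:
  assumes m: "is_mono C Z Q f" and c: "is_cover Z Q f"
  obtains s where "s \<in> Hom C Q Z" "f \<cdot> s = Idt C Q"
proof -
  have f: "f \<in> Hom C Z Q"
    using mono_Hom[OF m] .
  obtain n :: nat and A \<iota> where A: "\<And>i. i < n \<Longrightarrow> is_atom C (A i)"
    and Q: "is_coproduct C {..<n} A Q \<iota>"
    using decomposition[OF Hom_Obj(2)[OF f]] by metis
  have "\<exists>s \<in> Hom C (A i) Z. f \<cdot> s = \<iota> i" if i: "i \<in> {..<n}" for i
  proof -
    have Ai: "is_atom C (A i)" and \<iota>: "\<iota> i \<in> Hom C (A i) Q"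
      using A i coproduct_inj_Hom[OF Q i] by auto
    obtain P p q where P: "is_fiber_product C Z (A i) f (\<iota> i) P p q"
      using fiber_products[OF f \<iota>] by blast
    have p: "p \<in> Hom C P Z" and q: "q \<in> Hom C P (A i)" and fp: "f \<cdot> p = \<iota> i \<cdot> q"
      and uni: "\<And>W u v. u \<in> Hom C W Z \<Longrightarrow> v \<in> Hom C W (A i) \<Longrightarrow> f \<cdot> u = \<iota> i \<cdot> v \<Longrightarrow>
        \<exists>!h. h \<in> Hom C W P \<and> p \<cdot> h = u \<and> q \<cdot> h = v"
      using P Hom_Obj(1) by (simp_all add: is_fiber_product_def)
    \<comment> \<open>Monomorphisms are stable under pullback: maps into \<open>P\<close> that agree
      after \<open>q\<close> agree after \<open>p\<close> as well, since \<open>f\<close> is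
      monic.\<close>
    have q_mono: "is_mono C P (A i) q"
      unfolding is_mono_def
    proof (intro conjI ballI impI q)
      fix W g h
      assume g: "g \<in> Hom C W P" and h: "h \<in> Hom C W P" and eq: "q \<cdot> g = q \<cdot> h"
      have *: "f \<cdot> p \<cdot> x = \<iota> i \<cdot> q \<cdot> x" if "x \<in> Hom C W P" for x
        using Comp_assoc[OF that p f] Comp_assoc[OF that q \<iota>] fp by simp
      then have "f \<cdot> p \<cdot> g = f \<cdot> p \<cdot> h"
        using g h eq by simp
      then have "p \<cdot> g = p \<cdot> h"
        using mono_cancel[OF m Comp_in_Hom[OF g p] Comp_in_Hom[OF h p]] by blast
      then show "g = h"
        using uni[OF Comp_in_Hom[OF g p] Comp_in_Hom[OF g q] *[OF g]] g h eq by metis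
    qed
    \<comment> \<open>The covering property serves to produce a map from an atom into
      \<open>P\<close>, which shows that \<open>P\<close> is non-empty.\<close>
    obtain B \<beta> b where B: "is_atom C B" and \<beta>: "\<beta> \<in> Hom C B (A i)" "b \<in> Hom C B Z"
        "f \<cdot> b = \<iota> i \<cdot> \<beta>"
      using cover_lift[OF c Ai \<iota>] by metis
    then obtain x where x: "x \<in> Hom C B P"
      using uni by blast
    obtain D d where D: "is_atom C D" and d: "is_mono C D P d"
      using nonempty_has_atom[OF Hom_Obj(2)[OF x] no_Hom_atom_empty[OF B x]] by blast
    have "is_iso C D (A i) (q \<cdot> d)"
      using mono_atoms_iso[OF D Ai mono_comp[OF d q_mono]] .
    then obtain t where t: "t \<in> Hom C (A i) D" and qdt: "(q \<cdot> d) \<cdot> t = Idt C (A i)"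
      by (auto simp: is_iso_def)
    have dt: "d \<cdot> t \<in> Hom C (A i) P"
      using t mono_Hom[OF d] by (rule Comp_in_Hom)
    have "f \<cdot> p \<cdot> d \<cdot> t = \<iota> i \<cdot> q \<cdot> d \<cdot> t"
      using Comp_assoc[OF dt p f] Comp_assoc[OF dt q \<iota>] fp by simp
    also have "\<dots> = \<iota> i"
      using Comp_assoc[OF t mono_Hom[OF d] q] qdt Comp_Idt_right[OF \<iota>] by simp
    finally show ?thesis
      using Comp_in_Hom[OF dt p] by blast
  qed
  then obtain t where t: "\<And>i. i \<in> {..<n} \<Longrightarrow> t i \<in> Hom C (A i) Z"
    and ft: "\<And>i. i \<in> {..<n} \<Longrightarrow> f \<cdot> t i = \<iota> i"
    by metis
  obtain s where s: "s \<in> Hom C Q Z" and st: "\<And>i. i \<in> {..<n} \<Longrightarrow> s \<cdot> \<iota> i = t i"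
    using coproduct_desc[OF Q Hom_Obj(1)[OF f] t] by metis
  have "f \<cdot> s = Idt C Q"
  proof (rule coproduct_ext[OF Q Comp_in_Hom[OF s f] Idt_in_Hom[OF Hom_Obj(2)[OF f]]])
    fix i assume i: "i \<in> {..<n}"
    show "(f \<cdot> s) \<cdot> \<iota> i = Idt C Q \<cdot> \<iota> i"
      using Comp_assoc[OF coproduct_inj_Hom[OF Q i] s f] Comp_Idt_left[OF coproduct_inj_Hom[OF Q i]]
        st[OF i] ft[OF i] by simp
  qed
  with s show ?thesis
    by (rule that)
qed

end

section \<open>Image factorizations\<close>

context nondegenerate_B_category
begin

text \<open>Non-degeneracy makes the fiber product non-empty, and any atom inside it serves as the
  common refinement.\<close>

lemma atoms_common_refinement:
  assumes A: "is_atom C A" and B: "is_atom C B" and Z: "is_atom C Z"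
    and f: "f \<in> Hom C A Z" and g: "g \<in> Hom C B Z"
  obtains D a b where "is_atom C D" "a \<in> Hom C D A" "b \<in> Hom C D B" "f \<cdot> a = g \<cdot> b"
proof -
  obtain P p q where P: "is_fiber_product C A B f g P p q"
    using fiber_products[OF f g] by blast
  then have P_Obj: "P \<in> Obj C" and p: "p \<in> Hom C P A" and q: "q \<in> Hom C P B"
    and fp: "f \<cdot> p = g \<cdot> q"
    by (auto simp: is_fiber_product_def)
  obtain D d where D: "is_atom C D" and "is_mono C D P d"
    using nonempty_has_atom[OF P_Obj fiber_product_nonempty[OF A B Z f g P]] by blast
  then have d: "d \<in> Hom C D P"
    by (simp add: is_mono_def)
  have "f \<cdot> p \<cdot> d = g \<cdot> q \<cdot> d"
    using Comp_assoc[OF d p f] Comp_assoc[OF d q g] fp by simp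
  then show ?thesis
    using that D Comp_in_Hom[OF d p] Comp_in_Hom[OF d q] by blast
qed

text \<open>The image is the coproduct of those atomic summands of \<open>T\<close> that the map
  meets. A partial coproduct includes monically, and common refinements over a summand show that
  meeting it is enough to cover it.\<close>

lemma image_factorization:
  assumes h: "h \<in> Hom C X T"
  obtains Y e m where "is_cover X Y e" "is_mono C Y T m" "m \<cdot> e = h"
proof -
  obtain n :: nat and A \<iota> where A: "\<And>i. i < n \<Longrightarrow> is_atom C (A i)"
    and T: "is_coproduct C {..<n} A T \<iota>"
    by (rule decomposition[OF Hom_Obj(2)[OF h]], rule that)
  obtain l :: nat and B \<kappa> where B: "\<And>i. i < l \<Longrightarrow> is_atom C (B i)"
    and X: "is_coproduct C {..<l} B X \<kappa>"
    by (rule decomposition[OF Hom_Obj(1)[OF h]], rule that)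
  define S where "S = {k. k < n \<and>
    (\<exists>D b c. is_atom C D \<and> b \<in> Hom C D X \<and> c \<in> Hom C D (A k) \<and> h \<cdot> b = \<iota> k \<cdot> c)}"
  have S: "k \<in> {..<n}" if "k \<in> S" for k
    using that by (simp add: S_def)
  have fin: "finite S"
    by (simp add: S_def)
  have S_Obj: "A k \<in> Obj C" if "k \<in> S" for k
    using Hom_Obj(1)[OF coproduct_inj_Hom[OF T S[OF that]]] .
  obtain Y \<eta> where Y: "is_coproduct C S A Y \<eta>"
    using finite_coproduct_exists[of S A, OF fin S_Obj] by blast
  have \<eta>: "\<eta> k \<in> Hom C (A k) Y" if "k \<in> S" for k
    using coproduct_inj_Hom[OF Y that] .
  have Y_Obj: "Y \<in> Obj C"
    using Y by (simp add: is_coproduct_def)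
  obtain m where m: "m \<in> Hom C Y T" and m\<eta>: "\<And>k. k \<in> S \<Longrightarrow> m \<cdot> \<eta> k = \<iota> k"
    by (rule coproduct_desc[OF Y Hom_Obj(2)[OF h], of \<iota>],
      rule coproduct_inj_Hom[OF T S], assumption, rule that)
  have m\<eta>c: "m \<cdot> \<eta> k \<cdot> c = \<iota> k \<cdot> c" if "k \<in> S" "c \<in> Hom C D (A k)" for k c D
    using Comp_assoc[OF that(2) \<eta>[OF that(1)] m] m\<eta>[OF that(1)] by simp
  have m_mono: "is_mono C Y T m"
  proof (rule mono_if_atoms[OF m])
    fix D a b
    assume D: "is_atom C D" and a: "a \<in> Hom C D Y" and b: "b \<in> Hom C D Y" and eq: "m \<cdot> a = m \<cdot> b"
    obtain i a' where i: "i \<in> S" and a': "a' \<in> Hom C D (A i)" "a = \<eta> i \<cdot> a'"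
      using atom_factors_coproduct[OF fin D Y a] by blast
    obtain j b' where j: "j \<in> S" and b': "b' \<in> Hom C D (A j)" "b = \<eta> j \<cdot> b'"
      using atom_factors_coproduct[OF fin D Y b] by blast
    have "\<iota> i \<cdot> a' = \<iota> j \<cdot> b'"
      using m\<eta>c[OF i a'(1)] m\<eta>c[OF j b'(1)] eq a'(2) b'(2) by simp
    then have "i = j \<and> a' = b'"
      using atom_inj_coproduct[OF _ D T S[OF i] S[OF j] a'(1) b'(1)] by simp
    then show "a = b"
      using a'(2) b'(2) by simp
  qed
  \<comment> \<open>Each atomic summand of \<open>X\<close> lands in a single summand of
    \<open>T\<close>; its own injection witnesses that this summand belongs to
    \<open>S\<close>.\<close>
  have "\<exists>x \<in> Hom C (B i) Y. m \<cdot> x = h \<cdot> \<kappa> i" if i: "i \<in> {..<l}" for i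
  proof -
    have Bi: "is_atom C (B i)" and \<kappa>: "\<kappa> i \<in> Hom C (B i) X"
      using B i coproduct_inj_Hom[OF X i] by auto
    obtain k c where k: "k \<in> {..<n}" and c: "c \<in> Hom C (B i) (A k)" and hc: "h \<cdot> \<kappa> i = \<iota> k \<cdot> c"
      using atom_factors_coproduct[OF _ Bi T Comp_in_Hom[OF \<kappa> h]] by blast
    then have "k \<in> S"
      unfolding S_def using Bi \<kappa> by blast
    then show ?thesis
      using m\<eta>c[OF _ c] hc Comp_in_Hom[OF c \<eta>] by metis
  qed
  then obtain x where x: "\<And>i. i \<in> {..<l} \<Longrightarrow> x i \<in> Hom C (B i) Y"
    and mx: "\<And>i. i \<in> {..<l} \<Longrightarrow> m \<cdot> x i = h \<cdot> \<kappa> i"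
    by metis
  obtain e where e: "e \<in> Hom C X Y" and e\<kappa>: "\<And>i. i \<in> {..<l} \<Longrightarrow> e \<cdot> \<kappa> i = x i"
    by (rule coproduct_desc[OF X Y_Obj, of x], rule x, assumption, rule that)
  have me: "m \<cdot> e = h"
  proof (rule coproduct_ext[OF X Comp_in_Hom[OF e m] h])
    fix i assume i: "i \<in> {..<l}"
    show "(m \<cdot> e) \<cdot> \<kappa> i = h \<cdot> \<kappa> i"
      using Comp_assoc[OF coproduct_inj_Hom[OF X i] e m] e\<kappa>[OF i] mx[OF i] by simp
  qed
  have "is_cover X Y e"
    unfolding is_cover_def
  proof (intro conjI allI impI e)
    fix D a
    assume "is_atom C D \<and> a \<in> Hom C D Y"
    then have D: "is_atom C D" and a: "a \<in> Hom C D Y" by auto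
    obtain k a' where k: "k \<in> S" and a': "a' \<in> Hom C D (A k)" "a = \<eta> k \<cdot> a'"
      using atom_factors_coproduct[OF fin D Y a] by blast
    obtain E b c where E: "is_atom C E" and b: "b \<in> Hom C E X" and c: "c \<in> Hom C E (A k)"
      and hb: "h \<cdot> b = \<iota> k \<cdot> c"
      using k unfolding S_def by blast
    have "is_atom C (A k)"
      using A S[OF k] by simp
    \<comment> \<open>The atom \<open>E\<close> witnesses that \<open>k\<close> is in
      \<open>S\<close>. Refining \<open>D\<close> and \<open>E\<close> over the atom
      \<open>A k\<close> turns this one witness into a lift of the arbitrary map
      \<open>a'\<close>.\<close>
    then obtain G \<beta> \<gamma> where G: "is_atom C G" and \<beta>: "\<beta> \<in> Hom C G D" and \<gamma>: "\<gamma> \<in> Hom C G E"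
      and eq: "a' \<cdot> \<beta> = c \<cdot> \<gamma>"
      using atoms_common_refinement[OF D E _ a'(1) c] by metis
    have \<iota>: "\<iota> k \<in> Hom C (A k) T"
      using coproduct_inj_Hom[OF T S[OF k]] .
    have "m \<cdot> (e \<cdot> b \<cdot> \<gamma>) = (h \<cdot> b) \<cdot> \<gamma>"
      unfolding me[symmetric] using m e b \<gamma> by (simp add: cat_simps)
    also have "\<dots> = \<iota> k \<cdot> a' \<cdot> \<beta>"
      unfolding hb eq using \<iota> c \<gamma> by (simp add: cat_simps)
    also have "\<dots> = m \<cdot> (a \<cdot> \<beta>)"
      using m\<eta>c[OF k Comp_in_Hom[OF \<beta> a'(1)]] Comp_assoc[OF \<beta> a'(1) \<eta>[OF k]] a'(2) by simp
    finally have "e \<cdot> b \<cdot> \<gamma> = a \<cdot> \<beta>"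
      using mono_cancel[OF m_mono Comp_in_Hom[OF Comp_in_Hom[OF \<gamma> b] e] Comp_in_Hom[OF \<beta> a]] by blast
    then show "\<exists>B \<beta> b. is_atom C B \<and> \<beta> \<in> Hom C B D \<and> b \<in> Hom C B X \<and> e \<cdot> b = a \<cdot> \<beta>"
      using G \<beta> Comp_in_Hom[OF \<gamma> b] by blast
  qed
  then show ?thesis
    using m_mono me by (rule that)
qed

section \<open>Coequalizers as covers with smallest kernel\<close>

definition identifies :: "('m \<times> 'm) set \<Rightarrow> 'm \<Rightarrow> bool" where
  "identifies R f \<longleftrightarrow> (\<forall>(u, v) \<in> R. f \<cdot> u = f \<cdot> v)"

text \<open>All pairs are coequalized at once, and each may have its own source \<open>W\<close>; a
  whole diagram can therefore be treated without forming a coproduct of the sources.\<close>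

lemma joint_coequalizer:
  assumes X: "X \<in> Obj C"
    and R: "\<And>u v. (u, v) \<in> R \<Longrightarrow> \<exists>W. u \<in> Hom C W X \<and> v \<in> Hom C W X"
  obtains Q q where "q \<in> Hom C X Q" "identifies R q"
    "\<And>T f. f \<in> Hom C X T \<Longrightarrow> identifies R f \<Longrightarrow> \<exists>!h. h \<in> Hom C Q T \<and> h \<cdot> q = f"
proof -
  obtain P p r where p: "p \<in> Hom C P X" and r: "r \<in> Hom C P X"
    and P: "\<And>T u v. u \<in> Hom C T X \<Longrightarrow> v \<in> Hom C T X \<Longrightarrow>
      \<exists>!h. h \<in> Hom C T P \<and> p \<cdot> h = u \<and> r \<cdot> h = v"
    by (rule product_exists[OF X X], rule that)
  obtain n :: nat and D \<delta> where D: "\<And>i. i < n \<Longrightarrow> is_atom C (D i)"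
    and PD: "is_coproduct C {..<n} D P \<delta>"
    using decomposition[OF Hom_Obj(1)[OF p]] by metis
  \<comment> \<open>This finite set stands in for the kernel pair of \<open>f\<close>. On an atomic
    summand agreement is all or nothing: by \<open>atom_map_epi\<close> it spreads from any map of
    an atom into the summand to the entire summand.\<close>
  define K where "K f = {k. k < n \<and> f \<cdot> p \<cdot> \<delta> k = f \<cdot> r \<cdot> \<delta> k}" for f
  have fin: "finite (K f)" for f
    by (simp add: K_def)
  define adm where "adm Q q \<longleftrightarrow> is_cover X Q q \<and> identifies R q" for Q q
  have mono_identifies: "identifies R e"
    if m: "is_mono C Y T m" and e: "e \<in> Hom C X Y" and me: "identifies R (m \<cdot> e)" for Y T m e
    unfolding identifies_def
  proof safe
    fix u v assume uv: "(u, v) \<in> R"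
    then obtain W where u: "u \<in> Hom C W X" and v: "v \<in> Hom C W X"
      using R by blast
    have "(m \<cdot> e) \<cdot> u = (m \<cdot> e) \<cdot> v"
      using me uv by (auto simp: identifies_def)
    then have "m \<cdot> (e \<cdot> u) = m \<cdot> (e \<cdot> v)"
      using Comp_assoc[OF u e mono_Hom[OF m]] Comp_assoc[OF v e mono_Hom[OF m]] by simp
    then show "e \<cdot> u = e \<cdot> v"
      using mono_cancel[OF m Comp_in_Hom[OF u e] Comp_in_Hom[OF v e]] by blast
  qed
  \<comment> \<open>The image of the map to the final object is admissible, so a smallest kernel can
    be chosen.\<close>
  have "\<exists>Q q. adm Q q"
  proof -
    obtain F where F: "is_final C F"
      using final_object by blast
    then obtain t where t: "t \<in> Hom C X F"
      using X unfolding is_final_def by blast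
    have "identifies R t"
      unfolding identifies_def
    proof safe
      fix u v assume "(u, v) \<in> R"
      then obtain W where u: "u \<in> Hom C W X" and v: "v \<in> Hom C W X"
        using R by blast
      then show "t \<cdot> u = t \<cdot> v"
        using F Comp_in_Hom[OF u t] Comp_in_Hom[OF v t] Hom_Obj(1)[OF u]
        unfolding is_final_def by blast
    qed
    moreover obtain Q q m where "is_cover X Q q" "is_mono C Q F m" "m \<cdot> q = t"
      using image_factorization[OF t] by metis
    ultimately show ?thesis
      unfolding adm_def using mono_identifies cover_Hom by blast
  qed
  then obtain Q q where Qq: "adm Q q" and least: "\<And>Z e. adm Z e \<Longrightarrow> card (K q) \<le> card (K e)"
    using ex_has_least_nat[of "\<lambda>q. \<exists>Q. adm Q q" _ "\<lambda>q. card (K q)"] by metis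
  then have q_cover: "is_cover X Q q" and q_id: "identifies R q"
    by (auto simp: adm_def)
  have q: "q \<in> Hom C X Q"
    using cover_Hom[OF q_cover] .
  have "\<exists>h. h \<in> Hom C Q T \<and> h \<cdot> q = f" if f: "f \<in> Hom C X T" and f_id: "identifies R f" for T f
  proof -
    obtain QT \<pi> \<rho> where \<pi>: "\<pi> \<in> Hom C QT Q" and \<rho>: "\<rho> \<in> Hom C QT T"
      and QT: "\<And>W u v. u \<in> Hom C W Q \<Longrightarrow> v \<in> Hom C W T \<Longrightarrow>
        \<exists>!h. h \<in> Hom C W QT \<and> \<pi> \<cdot> h = u \<and> \<rho> \<cdot> h = v"
      by (rule product_exists[OF Hom_Obj(2)[OF q] Hom_Obj(2)[OF f]], rule that)
    obtain g where g: "g \<in> Hom C X QT" and \<pi>g: "\<pi> \<cdot> g = q" and \<rho>g: "\<rho> \<cdot> g = f"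
      using QT[OF q f] by blast
    obtain Z e m where e_cover: "is_cover X Z e" and m_mono: "is_mono C Z QT m" and me: "m \<cdot> e = g"
      using image_factorization[OF g] by metis
    have e: "e \<in> Hom C X Z" and m: "m \<in> Hom C Z QT"
      using cover_Hom[OF e_cover] mono_Hom[OF m_mono] by auto
    \<comment> \<open>The map \<open>z\<close> compares the image of the pair \<open>(q, f)\<close>
      with \<open>Q\<close>. The aim is a section of \<open>z\<close>, through which
      \<open>f\<close> can be recovered from \<open>q\<close>.\<close>
    define z where "z = \<pi> \<cdot> m"
    have z: "z \<in> Hom C Z Q"
      unfolding z_def using m \<pi> by (rule Comp_in_Hom)
    have ze: "z \<cdot> e = q"
      unfolding z_def using Comp_assoc[OF e m \<pi>] me \<pi>g by simp
    have "identifies R g"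
      unfolding identifies_def
    proof safe
      fix u v assume uv: "(u, v) \<in> R"
      then obtain W where u: "u \<in> Hom C W X" and v: "v \<in> Hom C W X"
        using R by blast
      have "\<pi> \<cdot> g \<cdot> u = \<pi> \<cdot> g \<cdot> v" "\<rho> \<cdot> g \<cdot> u = \<rho> \<cdot> g \<cdot> v"
        using Comp_assoc[OF u g \<pi>] Comp_assoc[OF v g \<pi>] Comp_assoc[OF u g \<rho>] Comp_assoc[OF v g \<rho>]
          \<pi>g \<rho>g q_id f_id uv by (auto simp: identifies_def)
      then show "g \<cdot> u = g \<cdot> v"
        using QT[OF Comp_in_Hom[OF Comp_in_Hom[OF v g] \<pi>] Comp_in_Hom[OF Comp_in_Hom[OF v g] \<rho>]]
          Comp_in_Hom[OF u g] Comp_in_Hom[OF v g] by metis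
    qed
    then have "adm Z e"
      unfolding adm_def using e_cover mono_identifies[OF m_mono e] me by simp
    \<comment> \<open>As \<open>q\<close> factors through \<open>e\<close>, whatever
      \<open>e\<close> identifies is identified by \<open>q\<close>; minimality of \<open>q\<close>
      then forces equality of the kernels.\<close>
    moreover have "K e \<subseteq> K q"
    proof
      fix k assume k: "k \<in> K e"
      then have \<delta>: "\<delta> k \<in> Hom C (D k) P"
        using coproduct_inj_Hom[OF PD] by (simp add: K_def)
      have "z \<cdot> e \<cdot> p \<cdot> \<delta> k = z \<cdot> e \<cdot> r \<cdot> \<delta> k"
        using k by (simp add: K_def)
      then show "k \<in> K q"
        using k Comp_assoc[OF Comp_in_Hom[OF \<delta> p] e z] Comp_assoc[OF Comp_in_Hom[OF \<delta> r] e z] ze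
        by (simp add: K_def)
    qed
    ultimately have Ke: "K e = K q"
      using least card_seteq[OF fin] by blast
    \<comment> \<open>Both \<open>a\<close> and \<open>b\<close> are lifted to \<open>X\<close> over
      a common atom \<open>G\<close>, giving \<open>a2\<close> and \<open>b2\<close> with the same
      image under \<open>q\<close>. The pair lands in one summand of \<open>P\<close>, which lies in
      the kernel of \<open>q\<close> and hence in that of \<open>e\<close>; so \<open>a\<close> and
      \<open>b\<close> agree on \<open>G\<close> and therefore on \<open>A\<close>.\<close>
    have z_mono: "is_mono C Z Q z"
    proof (rule mono_if_atoms[OF z])
      fix A a b
      assume A: "is_atom C A" and a: "a \<in> Hom C A Z" and b: "b \<in> Hom C A Z" and eq: "z \<cdot> a = z \<cdot> b"
      obtain B \<beta> a1 where B: "is_atom C B" and \<beta>: "\<beta> \<in> Hom C B A" and a1: "a1 \<in> Hom C B X"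
        and ea1: "e \<cdot> a1 = a \<cdot> \<beta>"
        using cover_lift[OF e_cover A a] by metis
      obtain G \<gamma> b2 where G: "is_atom C G" and \<gamma>: "\<gamma> \<in> Hom C G B" and b2: "b2 \<in> Hom C G X"
        and eb2: "e \<cdot> b2 = (b \<cdot> \<beta>) \<cdot> \<gamma>"
        using cover_lift[OF e_cover B Comp_in_Hom[OF \<beta> b]] by metis
      define a2 where "a2 = a1 \<cdot> \<gamma>"
      have a2: "a2 \<in> Hom C G X"
        unfolding a2_def using \<gamma> a1 by (rule Comp_in_Hom)
      have \<beta>\<gamma>: "\<beta> \<cdot> \<gamma> \<in> Hom C G A"
        using \<gamma> \<beta> by (rule Comp_in_Hom)
      have ea2: "e \<cdot> a2 = a \<cdot> \<beta> \<cdot> \<gamma>"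
        unfolding a2_def using Comp_assoc[OF \<gamma> a1 e] Comp_assoc[OF \<gamma> \<beta> a] ea1 by simp
      have eb2': "e \<cdot> b2 = b \<cdot> \<beta> \<cdot> \<gamma>"
        using Comp_assoc[OF \<gamma> \<beta> b] eb2 by simp
      have qab: "q \<cdot> a2 = q \<cdot> b2"
        using Comp_assoc[OF a2 e z] Comp_assoc[OF b2 e z] Comp_assoc[OF \<beta>\<gamma> a z]
          Comp_assoc[OF \<beta>\<gamma> b z] ea2 eb2' eq ze by simp
      obtain x where x: "x \<in> Hom C G P" and px: "p \<cdot> x = a2" and rx: "r \<cdot> x = b2"
        using P[OF a2 b2] by blast
      obtain k c where k: "k \<in> {..<n}" and c: "c \<in> Hom C G (D k)" and xc: "x = \<delta> k \<cdot> c"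
        using atom_factors_coproduct[OF _ G PD x] by blast
      have \<delta>: "\<delta> k \<in> Hom C (D k) P"
        using coproduct_inj_Hom[OF PD k] .
      have assoc: "(y \<cdot> p \<cdot> \<delta> k) \<cdot> c = y \<cdot> a2" "(y \<cdot> r \<cdot> \<delta> k) \<cdot> c = y \<cdot> b2"
        if "y \<in> Hom C X Y" for y Y
        unfolding px[symmetric] rx[symmetric] xc using that p r \<delta> c by (simp_all add: cat_simps)
      have "q \<cdot> p \<cdot> \<delta> k = q \<cdot> r \<cdot> \<delta> k"
      proof (rule atom_map_epi[OF _ G c])
        show "is_atom C (D k)"
          using D k by simp
        show "q \<cdot> p \<cdot> \<delta> k \<in> Hom C (D k) Q" "q \<cdot> r \<cdot> \<delta> k \<in> Hom C (D k) Q"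
          using Comp_in_Hom[OF Comp_in_Hom[OF \<delta> p] q] Comp_in_Hom[OF Comp_in_Hom[OF \<delta> r] q] .
        show "(q \<cdot> p \<cdot> \<delta> k) \<cdot> c = (q \<cdot> r \<cdot> \<delta> k) \<cdot> c"
          using assoc[OF q] qab by simp
      qed
      then have "k \<in> K e"
        unfolding Ke using k by (simp add: K_def)
      then have "e \<cdot> p \<cdot> \<delta> k = e \<cdot> r \<cdot> \<delta> k"
        by (simp add: K_def)
      then have "e \<cdot> a2 = e \<cdot> b2"
        using assoc[OF e] by simp
      then have "a \<cdot> \<beta> \<cdot> \<gamma> = b \<cdot> \<beta> \<cdot> \<gamma>"
        using ea2 eb2' by simp
      then show "a = b"
        using atom_map_epi[OF A G \<beta>\<gamma> a b] by blast
    qed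
    have "is_cover Z Q z"
      using cover_of_comp[OF _ e z] q_cover ze by simp
    then obtain s where s: "s \<in> Hom C Q Z" and zs: "z \<cdot> s = Idt C Q"
      using mono_cover_section[OF z_mono] by metis
    have "z \<cdot> (s \<cdot> q) = z \<cdot> e"
      using Comp_assoc[OF q s z] zs ze Comp_Idt_left[OF q] by simp
    then have sq: "s \<cdot> q = e"
      using mono_cancel[OF z_mono Comp_in_Hom[OF q s] e] by blast
    \<comment> \<open>The factorization of \<open>f\<close> runs back along the section into the
      image and then projects to \<open>T\<close>.\<close>
    have "(\<rho> \<cdot> m \<cdot> s) \<cdot> q = \<rho> \<cdot> m \<cdot> (s \<cdot> q)"
      using \<rho> m s q by (simp add: cat_simps)
    then have "(\<rho> \<cdot> m \<cdot> s) \<cdot> q = f"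
      using sq me \<rho>g by simp
    then show ?thesis
      using Comp_in_Hom[OF Comp_in_Hom[OF s m] \<rho>] by blast
  qed
  then have "\<exists>!h. h \<in> Hom C Q T \<and> h \<cdot> q = f" if "f \<in> Hom C X T" "identifies R f" for T f
    using that cover_epi[OF q_cover] by metis
  with q q_id show ?thesis
    by (rule that)
qed

section \<open>Finite colimits as quotients of finite coproducts\<close>

lemma finite_colimit_exists:
  assumes J: "finite_category J" and F: "is_functor J C Fo Fm"
  shows "\<exists>L \<kappa>. is_colimit J C Fo Fm L \<kappa>"
proof -
  have fin: "finite (Obj J)"
    using J by (simp add: finite_category_def)
  have Fo: "Fo x \<in> Obj C" if "x \<in> Obj J" for x
    using F that by (simp add: is_functor_def)
  have Fm: "Fm a \<in> Hom C (Fo x) (Fo y)" if "x \<in> Obj J" "y \<in> Obj J" "a \<in> Hom J x y" for x y a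
    using F that by (simp add: is_functor_def)
  obtain X \<iota> where X: "is_coproduct C (Obj J) Fo X \<iota>"
    using finite_coproduct_exists[of "Obj J" Fo, OF fin Fo] by blast
  have X_Obj: "X \<in> Obj C"
    using X by (simp add: is_coproduct_def)
  note \<iota> = coproduct_inj_Hom[OF X]
  \<comment> \<open>Each arrow \<open>a\<close> from \<open>x\<close> to \<open>y\<close>
    contributes two maps from \<open>Fo x\<close> into the coproduct: the direct injection, and the
    detour along \<open>Fm a\<close>.\<close>
  define R where "R = {(\<iota> y \<cdot> Fm a, \<iota> x) | x y a. x \<in> Obj J \<and> y \<in> Obj J \<and> a \<in> Hom J x y}"
  have "\<exists>W. u \<in> Hom C W X \<and> v \<in> Hom C W X" if "(u, v) \<in> R" for u v
    using that \<iota> Comp_in_Hom[OF Fm \<iota>] unfolding R_def by blast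
  then obtain Q q where q: "q \<in> Hom C X Q" and q_id: "identifies R q"
    and uni: "\<And>T f. f \<in> Hom C X T \<Longrightarrow> identifies R f \<Longrightarrow> \<exists>!h. h \<in> Hom C Q T \<and> h \<cdot> q = f"
    using joint_coequalizer[OF X_Obj, of R] by metis
  \<comment> \<open>Identifying \<open>R\<close> is exactly the cocone condition for the components
    of \<open>f\<close>, so the coequalizer of \<open>R\<close> classifies cocones.\<close>
  have identifies_iff: "identifies R f \<longleftrightarrow>
      (\<forall>x \<in> Obj J. \<forall>y \<in> Obj J. \<forall>a \<in> Hom J x y. (f \<cdot> \<iota> y) \<cdot> Fm a = f \<cdot> \<iota> x)"
    if f: "f \<in> Hom C X T" for f T
  proof -
    have "identifies R f \<longleftrightarrow>
        (\<forall>x \<in> Obj J. \<forall>y \<in> Obj J. \<forall>a \<in> Hom J x y. f \<cdot> \<iota> y \<cdot> Fm a = f \<cdot> \<iota> x)"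
      unfolding identifies_def R_def by blast
    moreover have "(f \<cdot> \<iota> y) \<cdot> Fm a = f \<cdot> \<iota> y \<cdot> Fm a" if "x \<in> Obj J" "y \<in> Obj J" "a \<in> Hom J x y" for x y a
      using Comp_assoc[OF Fm[OF that] \<iota>[OF that(2)] f] by simp
    ultimately show ?thesis
      by simp
  qed
  have "is_colimit J C Fo Fm Q (\<lambda>x. q \<cdot> \<iota> x)"
    unfolding is_colimit_def
  proof (intro conjI allI impI)
    show "is_cocone J C Fo Fm Q (\<lambda>x. q \<cdot> \<iota> x)"
      using Hom_Obj(2)[OF q] Comp_in_Hom[OF \<iota> q] q_id identifies_iff[OF q]
      by (simp add: is_cocone_def)
    fix T \<mu>
    assume "is_cocone J C Fo Fm T \<mu>"
    then have T: "T \<in> Obj C" and \<mu>: "\<And>x. x \<in> Obj J \<Longrightarrow> \<mu> x \<in> Hom C (Fo x) T"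
      and \<mu>_cocone: "\<forall>x \<in> Obj J. \<forall>y \<in> Obj J. \<forall>a \<in> Hom J x y. \<mu> y \<cdot> Fm a = \<mu> x"
      by (auto simp: is_cocone_def)
    obtain f where f: "f \<in> Hom C X T" and f\<iota>: "\<And>x. x \<in> Obj J \<Longrightarrow> f \<cdot> \<iota> x = \<mu> x"
      by (rule coproduct_desc[OF X T, of \<mu>], rule \<mu>, assumption, rule that)
    have "identifies R f"
      using \<mu>_cocone f\<iota> by (simp add: identifies_iff[OF f])
    \<comment> \<open>Factoring \<open>f\<close> through \<open>q\<close> amounts to factoring every
      leg of the cocone, so existence and uniqueness carry over together.\<close>
    moreover have "h \<cdot> q = f \<longleftrightarrow> (\<forall>x \<in> Obj J. h \<cdot> q \<cdot> \<iota> x = \<mu> x)" if h: "h \<in> Hom C Q T" for h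
    proof -
      have "(h \<cdot> q) \<cdot> \<iota> x = h \<cdot> q \<cdot> \<iota> x" if "x \<in> Obj J" for x
        using Comp_assoc[OF \<iota>[OF that] q h] by simp
      then show ?thesis
        using coproduct_ext[OF X Comp_in_Hom[OF q h] f] f\<iota> by auto
    qed
    ultimately show "\<exists>!h. h \<in> Hom C Q T \<and> (\<forall>x \<in> Obj J. h \<cdot> q \<cdot> \<iota> x = \<mu> x)"
      using uni[OF f] by metis
  qed
  then show ?thesis
    by blast
qed

end

theorem proposition4p6:
  fixes C :: "('o, 'm) cat" and J :: "('j, 'k) cat"
  assumes "nondegenerate_B_category C"
    and "finite_category J"
  shows "has_colimits_of_shape J C"
  using nondegenerate_B_category.finite_colimit_exists[OF assms]
  by (simp add: has_colimits_of_shape_def)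

end
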